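(* Let $(G_N)_{N\in\mathbb N}$ be a sequence of arbitrary finite groups with $|G_N|\to\infty$ and $(k_N)_{N\in\mathbb N}$ a sequence of positive integers; write $G=G_N$ and $k=k_N$. Suppose that $\liminf_N (k-\log_2|G|)/k>0$, $\log k\to\infty$ and $\log k/\log|G|\to0$. Let $G_k$ be the random Cayley graph (either directed or undirected) of $G$ with respect to $k$ independent uniformly random generators. Then $\mathrm{diam}\,G_k\le\mathfrak R(k,|G|)$ up to smaller order terms with high probability, i.e. for every $\varepsilon>0$, $$\mathbb P\big(\mathrm{diam}\,G_k\le(1+\varepsilon)\,\mathfrak R(k,|G|)\big)\to1\quad\text{as }N\to\infty.$$ Further, if $H=\mathbb Z_2^{d}$ (with $d=d_N\to\infty$ and $k$ satisfying the same conditions with $|H|=2^d$ in place of $|G|$), then $\mathrm{diam}\,H_k\eqsim\mathfrak R(k,2^d)=\mathfrak R(k,|H|)$ with high probability, i.e. $\mathrm{diam}\,H_k/\mathfrak R(k,2^d)\to1$ in probability.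
   Context: $\mathfrak R(k,n)$ denotes the minimal $R\in\mathbb N$ with $\binom kR\ge n$. For a finite group $G$ and a multiset $z=[z_1,\dots,z_k]$ of elements of $G$, the directed Cayley graph $G^+(z)$ has vertex set $G$ and edge multiset $[(g,gz_i): g\in G, i\le k]$; the undirected Cayley graph $G^-(z)$ has edge multiset $[\{g,gz_i\}: g\in G,i\le k]$. $G_k$ denotes either of $G^\pm(Z)$ with $Z=[Z_1,\dots,Z_k]$, where $Z_1,\dots,Z_k$ are independent and uniform on $G$. $\mathrm{diam}$ is the maximal graph distance between (ordered) pairs of vertices (along directed paths if directed; $\infty$ if some vertex cannot be reached from another). *)

theory Defs
  imports
    "HOL-Probability.Probability"
    "HOL-Algebra.Product_Groups"
    "HOL-Algebra.Elementary_Groups"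
    "Graph_Theory.Shortest_Path"
begin

text \<open>The minimum exists iff \<open>n\<close> is at most the central binomial coefficient of \<open>k\<close>; otherwise it is unspecified.\<close>

definition min_binomial :: "nat \<Rightarrow> nat \<Rightarrow> nat" where
  "min_binomial k n = (LEAST R. n \<le> k choose R)"

text \<open>
  The generator index is part of the arc, so that repeated
  generators give parallel arcs.
\<close>

definition cayley_digraph ::
    "('a, 'b) monoid_scheme \<Rightarrow> nat \<Rightarrow> (nat \<Rightarrow> 'a) \<Rightarrow> ('a, 'a \<times> nat) pre_digraph" where
  "cayley_digraph G k z =
     \<lparr>verts = carrier G, arcs = carrier G \<times> {..<k},
      tail = (\<lambda>(g, i). g), head = (\<lambda>(g, i). g \<otimes>\<^bsub>G\<^esub> z i)\<rparr>"

text \<open>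
  As usual in the digraph library, an undirected edge is a pair of opposite arcs; the Boolean
  component selects the direction of traversal.
\<close>

definition cayley_graph ::
    "('a, 'b) monoid_scheme \<Rightarrow> nat \<Rightarrow> (nat \<Rightarrow> 'a) \<Rightarrow> ('a, 'a \<times> nat \<times> bool) pre_digraph" where
  "cayley_graph G k z =
     \<lparr>verts = carrier G, arcs = carrier G \<times> {..<k} \<times> UNIV,
      tail = (\<lambda>(g, i, b). if b then g else g \<otimes>\<^bsub>G\<^esub> z i),
      head = (\<lambda>(g, i, b). if b then g \<otimes>\<^bsub>G\<^esub> z i else g)\<rparr>"

text \<open>
  With unit weights \<^term>\<open>wf_digraph.\<mu>\<close> is the least number of arcs of a walk,
  and it is infinite when there is no walk.
\<close>

definition graph_diameter :: "('v, 'e) pre_digraph \<Rightarrow> ereal" where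
  "graph_diameter D = (SUP (u, v) \<in> verts D \<times> verts D. wf_digraph.\<mu> D (\<lambda>_. 1) u v)"

lemma graph_diameter_awalk:
  assumes "wf_digraph D"
  shows "graph_diameter D = (SUP (u, v) \<in> verts D \<times> verts D.
           INF p \<in> {p. pre_digraph.awalk D u p v}. ereal (real (length p)))"
proof -
  interpret wf_digraph D by fact
  have "awalk_cost (\<lambda>_. 1) p = real (length p)" for p
    by (induction p) auto
  then show ?thesis
    by (simp add: graph_diameter_def \<mu>_def)
qed

text \<open>Independent uniform generators; their indices are \<open>0, \<dots>, k - 1\<close>.\<close>

definition random_generators :: "('a, 'b) monoid_scheme \<Rightarrow> nat \<Rightarrow> (nat \<Rightarrow> 'a) pmf" where
  "random_generators G k = Pi_pmf {..<k} undefined (\<lambda>_. pmf_of_set (carrier G))"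

definition Z2_power :: "nat \<Rightarrow> (nat \<Rightarrow> int) monoid" where
  "Z2_power d = product_group {..<d} (\<lambda>_. integer_mod_group 2)"

definition generator_regime :: "(nat \<Rightarrow> nat) \<Rightarrow> (nat \<Rightarrow> nat) \<Rightarrow> bool" where
  "generator_regime k n \<longleftrightarrow>
     (\<forall>N. k N > 0) \<and>
     liminf (\<lambda>N. ereal ((real (k N) - log 2 (real (n N))) / real (k N))) > 0 \<and>
     filterlim (\<lambda>N. ln (real (k N))) at_top sequentially \<and>
     (\<lambda>N. ln (real (k N)) / ln (real (n N))) \<longlonglongrightarrow> 0"

lemma wf_digraph_cayley_digraph:
  assumes "group G" and "\<And>i. i < k \<Longrightarrow> z i \<in> carrier G"
  shows "wf_digraph (cayley_digraph G k z)"
proof -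
  interpret group G by fact
  show ?thesis
    using assms(2) by unfold_locales (auto simp: cayley_digraph_def)
qed

lemma wf_digraph_cayley_graph:
  assumes "group G" and "\<And>i. i < k \<Longrightarrow> z i \<in> carrier G"
  shows "wf_digraph (cayley_graph G k z)"
proof -
  interpret group G by fact
  show ?thesis
    using assms(2) by unfold_locales (auto simp: cayley_graph_def)
qed

lemma group_Z2_power: "group (Z2_power d)"
  by (simp add: Z2_power_def)

lemma order_Z2_power: "order (Z2_power d) = 2 ^ d"
  by (simp add: Z2_power_def order_def carrier_integer_mod_group card_PiE)

end

theory Submission
  imports Defs "HOL-Algebra.FiniteProduct" "HOL-Real_Asymp.Real_Asymp"
begin

text \<open>
  Let \<open>R\<close> be the critical radius. Set \<open>m = \<eta> k\<close> generators aside, for a small \<open>\<eta>\<close>, and consider the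
  ordered products over the \<open>L\<close>-subsets of the other \<open>k - m\<close>, where \<open>L + 1\<close> is about \<open>(1 + \<epsilon>) R\<close>. These products
  are uniform and pairwise independent in any group, so by the second moment method each element
  is missed with probability at most \<open>n / ((k - m) choose L)\<close>, where \<open>n\<close> is the order. This tends to zero since
  \<open>R\<close> is at most \<open>(1/2 - c) k\<close>. Hence with high probability only a fraction \<open>\<beta>\<close> of the group is missed.
  One further step with one of the \<open>m\<close> reserved generators reaches everything outside an event of
  probability \<open>n * \<beta> ^ m\<close>, which is small because \<open>k\<close> exceeds \<open>log\<^sub>2 n\<close> and \<open>\<beta>\<close> is at our disposal.

  In an elementary abelian 2-group a walk of length at most \<open>r\<close> ends at the product over a set of at most \<open>r\<close>
  generators, so counting such sets gives the lower bound for every choice of generators.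
\<close>

section \<open>The second moment method\<close>

lemma measure_pair_pmf:
  "measure_pmf.prob (pair_pmf A B) S = (\<integral>a. measure_pmf.prob B {b. (a, b) \<in> S} \<partial>A)"
proof -
  have "ennreal (measure_pmf.prob (pair_pmf A B) S) = (\<integral>\<^sup>+p. indicator S p \<partial>pair_pmf A B)"
    by (simp add: measure_pmf.emeasure_eq_measure)
  also have "\<dots> = (\<integral>\<^sup>+a. \<integral>\<^sup>+b. indicator {b. (a, b) \<in> S} b \<partial>B \<partial>A)"
    by (simp add: nn_integral_pair_pmf' indicator_def)
  also have "\<dots> = (\<integral>\<^sup>+a. ennreal (measure_pmf.prob B {b. (a, b) \<in> S}) \<partial>A)"
    by (simp add: measure_pmf.emeasure_eq_measure)
  also have "\<dots> = ennreal (\<integral>a. measure_pmf.prob B {b. (a, b) \<in> S} \<partial>A)"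
    by (intro nn_integral_eq_integral measure_pmf.integrable_const_bound[where B = 1]) auto
  finally show ?thesis
    by (simp add: integral_nonneg_AE)
qed

lemma measure_pair_pmf_le:
  assumes "\<And>a. a \<in> set_pmf A \<Longrightarrow> measure_pmf.prob B {b. (a, b) \<in> S} \<le> c"
  shows "measure_pmf.prob (pair_pmf A B) S \<le> c"
  unfolding measure_pair_pmf
  by (intro measure_pmf.integral_le_const measure_pmf.integrable_const_bound[where B = 1])
    (auto simp: AE_measure_pmf_iff assms)

text \<open>Coordinate \<open>i\<close> is drawn last with all others frozen, so that an event can
  be studied through the law of this single coordinate.\<close>

lemma measure_Pi_pmf_resample:
  assumes "finite I" "i \<in> I"
  shows "measure_pmf.prob (Pi_pmf I d p) S =
    (\<integral>f. measure_pmf.prob (p i) {x. f(i := x) \<in> S} \<partial>Pi_pmf (I - {i}) d p)"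
proof -
  have "Pi_pmf I d p = Pi_pmf (insert i (I - {i})) d p"
    using assms by (simp add: insert_absorb)
  also have "\<dots> = map_pmf (\<lambda>(y, f). f(i := y)) (pair_pmf (p i) (Pi_pmf (I - {i}) d p))"
    using assms by (subst Pi_pmf_insert) auto
  also have "\<dots> = map_pmf (\<lambda>(f, y). f(i := y)) (pair_pmf (Pi_pmf (I - {i}) d p) (p i))"
    by (subst pair_commute_pmf) (simp add: pmf.map_comp o_def case_prod_unfold)
  finally show ?thesis
    by (simp add: measure_pair_pmf)
qed

text \<open>Chebyshev's inequality for the number of events that occur. Pairwise independence
  removes the off-diagonal covariances, so the variance is at most the mean
  \<open>card J * q\<close>, and missing every event is a deviation by the whole mean.\<close>

lemma second_moment_pmf:
  fixes E :: "'i \<Rightarrow> 'z set" and q :: real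
  assumes "finite J" "finite (set_pmf P)" "q > 0" "J \<noteq> {}"
    and single: "\<And>i. i \<in> J \<Longrightarrow> measure_pmf.prob P (E i) = q"
    and pair: "\<And>i j. i \<in> J \<Longrightarrow> j \<in> J \<Longrightarrow> i \<noteq> j \<Longrightarrow> measure_pmf.prob P (E i \<inter> E j) = q\<^sup>2"
  shows "measure_pmf.prob P {z. \<forall>i\<in>J. z \<notin> E i} \<le> 1 / (real (card J) * q)"
proof -
  let ?e = "\<lambda>i z. indicator (E i) z - q :: real"
  have int: "integrable (measure_pmf P) f" for f :: "'z \<Rightarrow> real"
    using assms by (intro integrable_measure_pmf_finite)
  have cov: "(\<integral>z. ?e i z * ?e j z \<partial>P) = (if i = j then q - q\<^sup>2 else 0)" if "i \<in> J" "j \<in> J" for i j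
  proof -
    have "(\<integral>z. ?e i z * ?e j z \<partial>P)
        = (\<integral>z. indicator (E i \<inter> E j) z - q * indicator (E i) z - q * indicator (E j) z + q\<^sup>2 \<partial>P)"
      by (intro Bochner_Integration.integral_cong)
        (auto simp: indicator_def algebra_simps power2_eq_square)
    also have "\<dots> = measure_pmf.prob P (E i \<inter> E j) - q\<^sup>2"
      by (simp add: int single that power2_eq_square)
    finally show ?thesis
      using that by (simp add: pair single)
  qed
  have pos: "real (card J) * q > 0"
    using assms by (simp add: card_gt_0_iff)
  have "(real (card J) * q)\<^sup>2 * measure_pmf.prob P {z. \<forall>i\<in>J. z \<notin> E i}
      = (\<integral>z. (real (card J) * q)\<^sup>2 * indicator {z. \<forall>i\<in>J. z \<notin> E i} z \<partial>P)"
    by simp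
  \<comment> \<open>If no event occurs, every summand is \<open>- q\<close> and the squared sum is
    exactly \<open>(card J * q)\<^sup>2\<close>; elsewhere the left side is zero.\<close>
  also have "\<dots> \<le> (\<integral>z. (\<Sum>i\<in>J. ?e i z)\<^sup>2 \<partial>P)"
    by (intro integral_mono int) (auto simp: indicator_def)
  also have "\<dots> = (\<Sum>i\<in>J. \<Sum>j\<in>J. \<integral>z. ?e i z * ?e j z \<partial>P)"
    by (simp add: power2_eq_square sum_product int)
  also have "\<dots> = (\<Sum>i\<in>J. q - q\<^sup>2)"
    by (intro sum.cong refl) (simp add: cov assms if_distrib cong: if_cong)
  also have "\<dots> \<le> real (card J) * q"
    by (simp add: mult_left_mono)
  finally have "(real (card J) * q) * (real (card J) * q * measure_pmf.prob P {z. \<forall>i\<in>J. z \<notin> E i}) \<le> (real (card J) * q) * 1"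
    by (simp add: power2_eq_square mult_ac)
  then have "real (card J) * q * measure_pmf.prob P {z. \<forall>i\<in>J. z \<notin> E i} \<le> 1"
    using pos by (simp only: mult_le_cancel_left_pos)
  then show ?thesis
    using pos by (simp add: field_simps)
qed

section \<open>Products of uniform generators\<close>

text \<open>Letters are generator indices, multiplied in the order of the list since the group need
  not be abelian; a set of indices becomes a word through \<open>sorted_list_of_set\<close>.\<close>

definition word_prod :: "('a, 'b) monoid_scheme \<Rightarrow> (nat \<Rightarrow> 'a) \<Rightarrow> nat list \<Rightarrow> 'a" where
  "word_prod G z xs = foldr (\<lambda>i y. z i \<otimes>\<^bsub>G\<^esub> y) xs \<one>\<^bsub>G\<^esub>"

lemma word_prod_simps [simp]:
  "word_prod G z [] = \<one>\<^bsub>G\<^esub>"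
  "word_prod G z (i # xs) = z i \<otimes>\<^bsub>G\<^esub> word_prod G z xs"
  by (simp_all add: word_prod_def)

lemma word_prod_cong:
  "(\<And>i. i \<in> set xs \<Longrightarrow> z i = z' i) \<Longrightarrow> word_prod G z xs = word_prod G z' xs"
  by (induction xs) auto

context group
begin

lemma word_prod_closed [simp]:
  "(\<And>i. i \<in> set xs \<Longrightarrow> z i \<in> carrier G) \<Longrightarrow> word_prod G z xs \<in> carrier G"
  by (induction xs) auto

lemma word_prod_append:
  assumes "\<And>i. i \<in> set (xs @ ys) \<Longrightarrow> z i \<in> carrier G"
  shows "word_prod G z (xs @ ys) = word_prod G z xs \<otimes> word_prod G z ys"
  using assms by (induction xs) (auto simp: m_assoc)

abbreviation uniform_tuple :: "nat set \<Rightarrow> (nat \<Rightarrow> 'a) pmf" where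
  "uniform_tuple I \<equiv> Pi_pmf I undefined (\<lambda>_. pmf_of_set (carrier G))"

lemma set_pmf_uniform:
  "finite (carrier G) \<Longrightarrow> set_pmf (pmf_of_set (carrier G)) = carrier G"
  by (intro set_pmf_of_set) auto

lemma set_uniform_tuple:
  "finite (carrier G) \<Longrightarrow> finite I \<Longrightarrow>
    set_pmf (uniform_tuple I) = PiE_dflt I undefined (\<lambda>_. carrier G)"
  by (simp add: set_Pi_pmf set_pmf_uniform)

lemma finite_set_uniform_tuple:
  "finite (carrier G) \<Longrightarrow> finite I \<Longrightarrow> finite (set_pmf (uniform_tuple I))"
  by (simp add: set_uniform_tuple finite_PiE_dflt)

text \<open>Resampling one letter of the word makes its product uniform whatever the other letters are.\<close>

lemma prob_word_prod:
  assumes fin: "finite (carrier G)" "finite I"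
    and xs: "distinct xs" "set xs \<subseteq> I" "i \<in> set xs"
    and g: "g \<in> carrier G"
    and Q: "\<And>f x. Q (f(i := x)) = Q f"
  shows "measure_pmf.prob (uniform_tuple I) {f. word_prod G f xs = g \<and> Q f}
       = measure_pmf.prob (uniform_tuple I) {f. Q f} / real (order G)"
proof -
  obtain ys zs where xs_eq: "xs = ys @ i # zs"
    using xs(3) by (meson split_list)
  have step: "measure_pmf.prob (pmf_of_set (carrier G)) {x. word_prod G (f(i := x)) xs = g \<and> Q (f(i := x))}
      = indicator {f. Q f} f / real (order G)" if f: "f \<in> set_pmf (uniform_tuple (I - {i}))" for f
  proof -
    let ?a = "word_prod G f ys" and ?b = "word_prod G f zs"
    have fc: "f j \<in> carrier G" if "j \<in> I" "j \<noteq> i" for j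
      using f that fin by (auto simp: set_uniform_tuple PiE_dflt_def)
    have ab: "?a \<in> carrier G" "?b \<in> carrier G"
      using xs xs_eq by (auto intro!: word_prod_closed fc)
    have wp: "word_prod G (f(i := x)) xs = ?a \<otimes> (x \<otimes> ?b)" if "x \<in> carrier G" for x
    proof -
      have "word_prod G (f(i := x)) ys = ?a" "word_prod G (f(i := x)) zs = ?b"
        using xs(1) xs_eq by (auto intro!: word_prod_cong)
      moreover have "word_prod G (f(i := x)) xs
          = word_prod G (f(i := x)) ys \<otimes> word_prod G (f(i := x)) (i # zs)"
        unfolding xs_eq using xs xs_eq that by (intro word_prod_append) (auto intro!: fc)
      ultimately show ?thesis by simp
    qed
    have iff: "?a \<otimes> (x \<otimes> ?b) = g \<longleftrightarrow> x = inv ?a \<otimes> g \<otimes> inv ?b" if x: "x \<in> carrier G" for x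
      using ab g x by (metis inv_closed inv_solve_left inv_solve_right m_assoc m_closed)
    \<comment> \<open>The equation for the resampled letter has exactly one solution and
      \<open>Q\<close> does not depend on that letter, so either one or none of the
      \<open>order G\<close> values is favourable.\<close>
    have "carrier G \<inter> {x. word_prod G (f(i := x)) xs = g \<and> Q (f(i := x))}
        = (if Q f then {inv ?a \<otimes> g \<otimes> inv ?b} else {})"
    proof -
      have "x \<in> carrier G \<Longrightarrow> word_prod G (f(i := x)) xs = g \<longleftrightarrow> x = inv ?a \<otimes> g \<otimes> inv ?b" for x
        by (simp only: wp iff)
      moreover have "inv ?a \<otimes> g \<otimes> inv ?b \<in> carrier G"
        using ab g by simp
      ultimately show ?thesis
        by (auto simp only: Q split: if_splits)
    qed
    then show ?thesis
      using fin by (subst measure_pmf_of_set) (auto simp: order_def indicator_def)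
  qed
  have iI: "i \<in> I" using xs by auto
  have "measure_pmf.prob (uniform_tuple I) {f. word_prod G f xs = g \<and> Q f}
      = (\<integral>f. indicator {f. Q f} f / real (order G) \<partial>uniform_tuple (I - {i}))"
    unfolding measure_Pi_pmf_resample[OF fin(2) iI]
    by (intro integral_cong_AE) (auto simp: AE_measure_pmf_iff step)
  also have "\<dots> = (\<integral>f. indicator {f. Q f} f \<partial>uniform_tuple (I - {i})) / real (order G)"
    by simp
  also have "(\<integral>f. indicator {f. Q f} f \<partial>uniform_tuple (I - {i}))
      = measure_pmf.prob (uniform_tuple I) {f. Q f}"
    unfolding measure_Pi_pmf_resample[OF fin(2) iI]
    by (intro Bochner_Integration.integral_cong) (auto simp: Q indicator_def)
  finally show ?thesis .
qed

text \<open>The events for different \<open>A\<close> are pairwise independent, because two distinct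
  sets of equal size each contain an index that the other lacks; \<open>second_moment_pmf\<close>
  applies with \<open>q\<close> the reciprocal of the order.\<close>

lemma prob_subset_products_miss:
  assumes fin: "finite (carrier G)" and L: "0 < L" "L \<le> K" and g: "g \<in> carrier G"
  shows "measure_pmf.prob (uniform_tuple {..<K})
      {f. \<forall>A\<in>{A. A \<subseteq> {..<K} \<and> card A = L}. word_prod G f (sorted_list_of_set A) \<noteq> g}
    \<le> real (order G) / real (K choose L)"
proof -
  define J where "J = {A. A \<subseteq> {..<K} \<and> card A = L}"
  define E where "E A = {f. word_prod G f (sorted_list_of_set A) = g}" for A
  have cJ: "card J = K choose L"
    by (simp add: J_def n_subsets)
  have fJ: "finite J" by (simp add: J_def)
  have finA: "finite A" "A \<subseteq> {..<K}" if "A \<in> J" for A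
    using that finite_subset by (auto simp: J_def)
  have n: "order G > 0"
    using fin by (simp add: order_gt_0_iff_finite)
  have Jne: "J \<noteq> {}"
    using cJ L by (metis card.empty binomial_eq_0_iff not_le)
  have single: "measure_pmf.prob (uniform_tuple {..<K}) (E A) = 1 / real (order G)" if "A \<in> J" for A
  proof -
    have "A \<noteq> {}"
      using that L by (auto simp: J_def)
    then obtain i where "i \<in> A"
      by blast
    then show ?thesis
      using prob_word_prod[of "{..<K}" "sorted_list_of_set A" i g "\<lambda>_. True"] fin g finA[OF that]
      by (simp add: E_def)
  qed
  have pair: "measure_pmf.prob (uniform_tuple {..<K}) (E A \<inter> E B) = (1 / real (order G))\<^sup>2"
    if AB: "A \<in> J" "B \<in> J" "A \<noteq> B" for A B
  proof -
    have "\<not> A \<subseteq> B"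
      using AB finA card_subset_eq by (metis (mono_tags, lifting) J_def mem_Collect_eq)
    then obtain i where i: "i \<in> A" "i \<notin> B" by auto
    \<comment> \<open>The word of \<open>B\<close> avoids \<open>i\<close>, so its event can serve
      as the side condition of \<open>prob_word_prod\<close> when letter \<open>i\<close> of the
      word of \<open>A\<close> is resampled.\<close>
    have Q: "(word_prod G (f(i := x)) (sorted_list_of_set B) = g)
        = (word_prod G f (sorted_list_of_set B) = g)" for f x
      using i finA[OF AB(2)] by (subst word_prod_cong[of _ "f(i := x)" f]) auto
    have "measure_pmf.prob (uniform_tuple {..<K}) (E A \<inter> E B)
        = measure_pmf.prob (uniform_tuple {..<K}) (E B) / real (order G)"
      using prob_word_prod[of "{..<K}" "sorted_list_of_set A" i g
        "\<lambda>f. word_prod G f (sorted_list_of_set B) = g"] fin g finA[OF AB(1)] i Q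
      by (simp add: E_def Int_def)
    then show ?thesis
      using single[OF AB(2)] by (simp add: power2_eq_square)
  qed
  have "measure_pmf.prob (uniform_tuple {..<K}) {f. \<forall>A\<in>J. f \<notin> E A} \<le> 1 / (real (card J) * (1 / real (order G)))"
    using n by (intro second_moment_pmf fJ finite_set_uniform_tuple fin Jne single pair) auto
  then show ?thesis
    by (simp add: J_def[symmetric] E_def cJ)
qed

end

section \<open>Diameters of Cayley graphs\<close>

lemma graph_diameter_le:
  assumes "wf_digraph D"
    and "\<And>u v. u \<in> verts D \<Longrightarrow> v \<in> verts D \<Longrightarrow> \<exists>p. pre_digraph.awalk D u p v \<and> length p \<le> r"
  shows "graph_diameter D \<le> ereal (real r)"
  unfolding graph_diameter_awalk[OF assms(1)]
proof (rule SUP_least, clarify)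
  fix u v assume "u \<in> verts D" "v \<in> verts D"
  then obtain p where "pre_digraph.awalk D u p v" "length p \<le> r"
    using assms(2) by blast
  then show "(INF p\<in>{p. pre_digraph.awalk D u p v}. ereal (real (length p))) \<le> ereal (real r)"
    by (intro INF_lower2[of p]) auto
qed

lemma graph_diameter_less_awalk:
  assumes "wf_digraph D" "graph_diameter D < x" "u \<in> verts D" "v \<in> verts D"
  obtains p where "pre_digraph.awalk D u p v" "ereal (real (length p)) < x"
proof -
  have "(INF p\<in>{p. pre_digraph.awalk D u p v}. ereal (real (length p))) \<le> graph_diameter D"
    unfolding graph_diameter_awalk[OF assms(1)] using assms(3,4)
    by (intro SUP_upper2[of "(u, v)"]) auto
  also have "\<dots> < x" by fact
  finally show thesis
    using that by (auto simp: INF_less_iff)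
qed

context group
begin

lemma awalk_cayley_digraph:
  assumes "\<And>i. i \<in> set xs \<Longrightarrow> i < k" "\<And>i. i < k \<Longrightarrow> z i \<in> carrier G" "u \<in> carrier G"
  shows "\<exists>p. pre_digraph.awalk (cayley_digraph G k z) u p (u \<otimes> word_prod G z xs) \<and> length p = length xs"
  using assms
proof (induction xs arbitrary: u)
  case Nil
  then show ?case
    by (intro exI[of _ "[]"]) (simp add: pre_digraph.awalk_def pre_digraph.cas.simps cayley_digraph_def)
next
  case (Cons i xs)
  have zi: "z i \<in> carrier G" using Cons.prems by auto
  then obtain p where
    "pre_digraph.awalk (cayley_digraph G k z) (u \<otimes> z i) p (u \<otimes> z i \<otimes> word_prod G z xs)"
    "length p = length xs"
    using Cons.IH[of "u \<otimes> z i"] Cons.prems by auto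
  then show ?case
    using Cons.prems zi
    by (intro exI[of _ "(u, i) # p"])
      (auto simp: pre_digraph.awalk_def pre_digraph.cas.simps cayley_digraph_def m_assoc)
qed

lemma awalk_cayley_graph_of_digraph:
  assumes "pre_digraph.awalk (cayley_digraph G k z) u p v"
  shows "pre_digraph.awalk (cayley_graph G k z) u (map (\<lambda>(g, i). (g, i, True)) p) v"
proof -
  have "pre_digraph.cas (cayley_digraph G k z) u p v \<Longrightarrow>
      pre_digraph.cas (cayley_graph G k z) u (map (\<lambda>(g, i). (g, i, True)) p) v"
    by (induction p arbitrary: u)
      (auto simp: pre_digraph.cas.simps cayley_digraph_def cayley_graph_def)
  with assms show ?thesis
    by (auto simp: pre_digraph.awalk_def cayley_digraph_def cayley_graph_def)
qed

text \<open>A directed walk is also an undirected one. Hence upper bounds are needed only for the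
  directed graph and lower bounds only for the undirected one.\<close>

lemma graph_diameter_cayley_graph_le:
  assumes "\<And>i. i < k \<Longrightarrow> z i \<in> carrier G"
  shows "graph_diameter (cayley_graph G k z) \<le> graph_diameter (cayley_digraph G k z)"
proof -
  have wf: "wf_digraph (cayley_digraph G k z)" "wf_digraph (cayley_graph G k z)"
    using assms by (auto intro!: wf_digraph_cayley_digraph wf_digraph_cayley_graph is_group)
  have "(INF p\<in>{p. pre_digraph.awalk (cayley_graph G k z) u p v}. ereal (real (length p)))
      \<le> (INF p\<in>{p. pre_digraph.awalk (cayley_digraph G k z) u p v}. ereal (real (length p)))" for u v
    by (rule INF_mono)
      (auto dest!: awalk_cayley_graph_of_digraph intro!: exI[of _ "map (\<lambda>(g, i). (g, i, True)) _"])
  then show ?thesis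
    unfolding graph_diameter_awalk[OF wf(1)] graph_diameter_awalk[OF wf(2)]
    by (intro SUP_mono) (force simp: cayley_digraph_def cayley_graph_def)
qed

text \<open>Left translation is a symmetry of the graph, so a word for
  \<open>inv u \<otimes> v\<close> read from \<open>u\<close> leads to \<open>v\<close>.\<close>

lemma diameter_le_of_words:
  assumes "\<And>i. i < k \<Longrightarrow> z i \<in> carrier G"
    and "\<And>g. g \<in> carrier G \<Longrightarrow> \<exists>xs. set xs \<subseteq> {..<k} \<and> length xs \<le> r \<and> word_prod G z xs = g"
  shows "graph_diameter (cayley_digraph G k z) \<le> ereal (real r)"
proof (rule graph_diameter_le)
  show "wf_digraph (cayley_digraph G k z)"
    by (rule wf_digraph_cayley_digraph[OF is_group assms(1)])
next
  fix u v assume "u \<in> verts (cayley_digraph G k z)" "v \<in> verts (cayley_digraph G k z)"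
  then have uv: "u \<in> carrier G" "v \<in> carrier G"
    by (auto simp: cayley_digraph_def)
  then obtain xs where xs: "set xs \<subseteq> {..<k}" "length xs \<le> r" "word_prod G z xs = inv u \<otimes> v"
    using assms(2)[of "inv u \<otimes> v"] by auto
  then have "u \<otimes> word_prod G z xs = v"
    using uv by (simp add: m_assoc[symmetric])
  then show "\<exists>p. pre_digraph.awalk (cayley_digraph G k z) u p v \<and> length p \<le> r"
    using awalk_cayley_digraph[of xs k z u] xs assms(1) uv by (metis lessThan_iff subsetD)
qed

text \<open>
  Words of length \<open>L\<close> in the first \<open>K\<close> generators miss few elements, and the remaining generators
  offer every element \<open>g\<close> many independent chances \<open>g = w \<otimes> z j\<close> with \<open>w\<close> such a word.
\<close>

lemma prob_diameter_cayley_digraph: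
  assumes fin: "finite (carrier G)" and L: "0 < L" "L \<le> K" and \<beta>: "0 < \<beta>"
  shows "measure_pmf.prob (random_generators G (K + m))
      {z. \<not> graph_diameter (cayley_digraph G (K + m) z) \<le> ereal (real (L + 1))}
    \<le> real (order G) / (\<beta> * real (K choose L)) + real (order G) * \<beta> ^ m"
proof -
  define P where "P = uniform_tuple {..<K}"
  define Q where "Q = uniform_tuple {K..<K + m}"
  define C where "C f = {g \<in> carrier G. \<forall>A\<in>{A. A \<subseteq> {..<K} \<and> card A = L}.
    word_prod G f (sorted_list_of_set A) \<noteq> g}" for f
  define n where "n = real (order G)"
  define M where "M = real (K choose L)"
  define glue :: "(nat \<Rightarrow> 'a) \<times> (nat \<Rightarrow> 'a) \<Rightarrow> nat \<Rightarrow> 'a" where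
    "glue = (\<lambda>(f, h) x. if x \<in> {..<K} then f x else h x)"
  \<comment> \<open>\<open>C f\<close> holds the elements missed by the subset products;
    \<open>S\<close> is the failure of the final step for some target \<open>g\<close>, and
    \<open>T\<close> the event that too many elements are missed.\<close>
  define S where "S = {(f, h). \<exists>g\<in>carrier G. \<forall>j\<in>{K..<K + m}. g \<otimes> inv (h j) \<in> C f}"
  define T where "T = {f. n * \<beta> \<le> real (card (C f))}"
  have n: "n > 0"
    using fin by (simp add: n_def order_gt_0_iff_finite)
  have M: "M > 0"
    using L by (simp add: M_def)
  have finC: "finite (C f)" for f
    using fin by (simp add: C_def)
  have finP: "finite (set_pmf P)"
    unfolding P_def by (intro finite_set_uniform_tuple fin) simp
  have int: "integrable (measure_pmf P) f" for f :: "(nat \<Rightarrow> 'a) \<Rightarrow> real"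
    by (intro integrable_measure_pmf_finite finP)

  have rg: "random_generators G (K + m) = map_pmf glue (pair_pmf P Q)"
  proof -
    have "{..<K + m} = {..<K} \<union> {K..<K + m}" by auto
    moreover have "uniform_tuple ({..<K} \<union> {K..<K + m}) = map_pmf glue (pair_pmf P Q)"
      unfolding P_def Q_def glue_def by (intro Pi_pmf_union) auto
    ultimately show ?thesis
      by (simp only: random_generators_def)
  qed

  have bad: "(f, h) \<in> S"
    if fh: "f \<in> set_pmf P" "h \<in> set_pmf Q"
      and diam: "\<not> graph_diameter (cayley_digraph G (K + m) (glue (f, h))) \<le> ereal (real (L + 1))" for f h
  proof (rule ccontr)
    assume nS: "(f, h) \<notin> S"
    let ?z = "glue (f, h)"
    have fc: "f i \<in> carrier G" if "i < K" for i
      using fh(1) that fin by (auto simp: P_def set_uniform_tuple PiE_dflt_def)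
    have hc: "h i \<in> carrier G" if "K \<le> i" "i < K + m" for i
      using fh(2) that fin by (auto simp: Q_def set_uniform_tuple PiE_dflt_def)
    have zc: "?z i \<in> carrier G" if "i < K + m" for i
      using that by (auto simp: glue_def intro: fc hc)
    have "\<exists>xs. set xs \<subseteq> {..<K + m} \<and> length xs \<le> L + 1 \<and> word_prod G ?z xs = g"
      if g: "g \<in> carrier G" for g
    proof -
      \<comment> \<open>Outside \<open>S\<close> some reserved index \<open>j\<close> makes
        \<open>g \<otimes> inv (h j)\<close> a subset product, and appending \<open>j\<close> to its
        word spells \<open>g\<close>.\<close>
      obtain j where j: "K \<le> j" "j < K + m" "g \<otimes> inv (h j) \<notin> C f"
        using nS g unfolding S_def by (simp add: Bex_def) blast
      then obtain A where A: "A \<subseteq> {..<K}" "card A = L"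
        "word_prod G f (sorted_list_of_set A) = g \<otimes> inv (h j)"
        using g hc[of j] by (auto simp: C_def)
      have finA: "finite A"
        using A(1) finite_subset by blast
      have "word_prod G ?z (sorted_list_of_set A) = word_prod G f (sorted_list_of_set A)"
        using A(1) finA by (intro word_prod_cong) (auto simp: glue_def)
      moreover have "word_prod G ?z (sorted_list_of_set A @ [j])
          = word_prod G ?z (sorted_list_of_set A) \<otimes> word_prod G ?z [j]"
        using A(1) finA j by (intro word_prod_append zc) auto
      ultimately have "word_prod G ?z (sorted_list_of_set A @ [j]) = g"
        using A(3) g j hc[of j] by (simp add: glue_def m_assoc)
      then show ?thesis
        using A(1,2) finA j by (intro exI[of _ "sorted_list_of_set A @ [j]"]) auto
    qed
    from diameter_le_of_words[OF zc this] diam show False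
      by simp
  qed

  \<comment> \<open>The expected number of missed elements is the sum of the miss probabilities;
    Markov's inequality then bounds \<open>T\<close>.\<close>
  have "(\<integral>f. real (card (C f)) \<partial>P) = (\<integral>f. (\<Sum>g\<in>carrier G. indicator {f. g \<in> C f} f) \<partial>P)"
  proof (intro Bochner_Integration.integral_cong refl)
    fix f
    have "card (C f) = card (carrier G \<inter> {g. g \<in> C f})"
      by (auto simp: C_def intro!: arg_cong[where f = card])
    then show "real (card (C f)) = (\<Sum>g\<in>carrier G. indicator {f. g \<in> C f} f)"
      using fin by (simp add: indicator_def sum.If_cases)
  qed
  also have "\<dots> = (\<Sum>g\<in>carrier G. measure_pmf.prob P {f. g \<in> C f})"
    by (simp add: int)
  also have "\<dots> \<le> (\<Sum>g\<in>carrier G. n / M)"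
    using prob_subset_products_miss[OF fin L]
    by (intro sum_mono) (simp add: C_def P_def n_def M_def)
  finally have mean: "(\<integral>f. real (card (C f)) \<partial>P) \<le> n * (n / M)"
    by (simp add: n_def order_def)
  have T: "measure_pmf.prob P T \<le> n / (\<beta> * M)"
  proof -
    have "measure_pmf.prob P T \<le> (\<integral>f. real (card (C f)) \<partial>P) / (n * \<beta>)"
      using integral_Markov_inequality_measure[of "measure_pmf P" "\<lambda>f. real (card (C f))" UNIV "n * \<beta>"]
        n \<beta> by (simp add: int T_def)
    also have "\<dots> \<le> n * (n / M) / (n * \<beta>)"
      using mean n \<beta> by (intro divide_right_mono) auto
    also have "\<dots> = n / (\<beta> * M)"
      using n by simp
    finally show ?thesis .
  qed

  have hit: "measure_pmf.prob Q {h. (f, h) \<in> S \<and> f \<notin> T} \<le> n * \<beta> ^ m" for f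
  proof (cases "f \<in> T")
    case False
    have one: "measure_pmf.prob Q {h. \<forall>j\<in>{K..<K + m}. g \<otimes> inv (h j) \<in> C f} \<le> \<beta> ^ m"
      if g: "g \<in> carrier G" for g
    proof -
      have "{h. \<forall>j\<in>{K..<K + m}. g \<otimes> inv (h j) \<in> C f} = Pi {K..<K + m} (\<lambda>_. {x. g \<otimes> inv x \<in> C f})"
        by auto
      then have "measure_pmf.prob Q {h. \<forall>j\<in>{K..<K + m}. g \<otimes> inv (h j) \<in> C f}
          = (measure_pmf.prob (pmf_of_set (carrier G)) {x. g \<otimes> inv x \<in> C f}) ^ m"
        by (simp add: Q_def measure_Pi_pmf_Pi)
      also have "\<dots> \<le> \<beta> ^ m"
      proof (intro power_mono measure_nonneg)
        \<comment> \<open>The map sending \<open>x\<close> to \<open>g \<otimes> inv x\<close> is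
          injective, so the bad values of a reserved generator are no more numerous than
          \<open>C f\<close>, which has fewer than \<open>n * \<beta>\<close> elements outside
          \<open>T\<close>.\<close>
        have "card (carrier G \<inter> {x. g \<otimes> inv x \<in> C f}) \<le> card (C f)"
        proof (rule card_inj_on_le[OF _ _ finC])
          show "inj_on (\<lambda>x. g \<otimes> inv x) (carrier G \<inter> {x. g \<otimes> inv x \<in> C f})"
            using g by (auto simp: inj_on_def dest: inv_inj[THEN inj_onD])
        qed auto
        also have "real (card (C f)) \<le> n * \<beta>"
          using False by (simp add: T_def)
        finally have "real (card (carrier G \<inter> {x. g \<otimes> inv x \<in> C f})) / n \<le> \<beta>"
          using n by (simp add: field_simps)
        then show "measure_pmf.prob (pmf_of_set (carrier G)) {x. g \<otimes> inv x \<in> C f} \<le> \<beta>"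
          using fin by (subst measure_pmf_of_set) (auto simp: n_def order_def)
      qed
      finally show ?thesis .
    qed
    \<comment> \<open>The set \<open>C f\<close> depends on \<open>f\<close> alone, so for fixed
      \<open>f\<close> the reserved generators are independent trials; a union bound runs over all
      targets \<open>g\<close>.\<close>
    have "measure_pmf.prob Q {h. (f, h) \<in> S \<and> f \<notin> T}
        = measure_pmf.prob Q (\<Union>g\<in>carrier G. {h. \<forall>j\<in>{K..<K + m}. g \<otimes> inv (h j) \<in> C f})"
      using False by (intro arg_cong[where f = "measure_pmf.prob Q"]) (auto simp: S_def)
    also have "\<dots> \<le> (\<Sum>g\<in>carrier G. measure_pmf.prob Q {h. \<forall>j\<in>{K..<K + m}. g \<otimes> inv (h j) \<in> C f})"
      by (intro measure_pmf.finite_measure_subadditive_finite fin) auto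
    also have "\<dots> \<le> (\<Sum>g\<in>carrier G. \<beta> ^ m)"
      by (intro sum_mono one)
    finally show ?thesis
      by (simp add: n_def order_def)
  qed (use n \<beta> in simp)

  have "measure_pmf.prob (random_generators G (K + m))
      {z. \<not> graph_diameter (cayley_digraph G (K + m) z) \<le> ereal (real (L + 1))}
    = measure_pmf.prob (pair_pmf P Q) {p. \<not> graph_diameter (cayley_digraph G (K + m) (glue p)) \<le> ereal (real (L + 1))}"
    by (simp add: rg vimage_def)
  also have "\<dots> \<le> measure_pmf.prob (pair_pmf P Q) ((T \<times> UNIV) \<union> {(f, h). (f, h) \<in> S \<and> f \<notin> T})"
    using bad by (intro measure_pmf.finite_measure_mono_AE) (auto simp: AE_measure_pmf_iff)
  also have "\<dots> \<le> measure_pmf.prob (pair_pmf P Q) (T \<times> UNIV)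
      + measure_pmf.prob (pair_pmf P Q) {(f, h). (f, h) \<in> S \<and> f \<notin> T}"
    by (intro measure_Un_le) auto
  also have "measure_pmf.prob (pair_pmf P Q) (T \<times> UNIV) = measure_pmf.prob (map_pmf fst (pair_pmf P Q)) T"
    by (simp only: measure_map_pmf fst_vimage_eq_Times)
  also have "\<dots> \<le> n / (\<beta> * M)"
    using T by (simp add: map_fst_pair_pmf)
  also have "measure_pmf.prob (pair_pmf P Q) {(f, h). (f, h) \<in> S \<and> f \<notin> T} \<le> n * \<beta> ^ m"
    by (rule measure_pair_pmf_le) (use hit in simp)
  finally show ?thesis
    by (simp add: n_def M_def)
qed

end

section \<open>Counting bound for abelian groups of exponent two\<close>

lemma card_bounded_subsets:
  "card {A. A \<subseteq> {..<k} \<and> card A \<le> r} = (\<Sum>j\<le>r. k choose j)" for k r :: nat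
proof -
  have "{A. A \<subseteq> {..<k} \<and> card A \<le> r} = (\<Union>j\<le>r. {A. A \<subseteq> {..<k} \<and> card A = j})"
    by auto
  also have "card \<dots> = (\<Sum>j\<le>r. card {A. A \<subseteq> {..<k} \<and> card A = j})"
    by (intro card_UN_disjoint) auto
  finally show ?thesis
    by (simp add: n_subsets)
qed

context comm_group
begin

text \<open>In a group of exponent two, the direction and the repetition of steps are immaterial.\<close>

lemma order_le_if_cayley_graph_diameter:
  assumes fin: "finite (carrier G)" and z: "\<And>i. i < k \<Longrightarrow> z i \<in> carrier G"
    and sq: "\<And>x. x \<in> carrier G \<Longrightarrow> x \<otimes> x = \<one>"
    and diam: "graph_diameter (cayley_graph G k z) < ereal (real (Suc r))"
  shows "order G \<le> (\<Sum>j\<le>r. k choose j)"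
proof -
  let ?D = "cayley_graph G k z"
  have wf: "wf_digraph ?D"
    using z by (intro wf_digraph_cayley_graph is_group)
  \<comment> \<open>An arc traversed backwards also multiplies on the right by \<open>z i\<close>,
    because \<open>z i\<close> is its own inverse.\<close>
  have step: "\<exists>i<k. head ?D e = tail ?D e \<otimes> z i" if arc: "e \<in> arcs ?D" for e
  proof -
    obtain g i b where e: "e = (g, i, b)" "g \<in> carrier G" "i < k"
      using arc by (auto simp: cayley_graph_def)
    then have "g \<otimes> z i \<otimes> z i = g"
      using z[of i] sq[of "z i"] by (simp add: m_assoc)
    then show ?thesis
      using e by (auto simp: cayley_graph_def)
  qed
  \<comment> \<open>The set \<open>A\<close> built here records the generators used an odd number of
    times: each step toggles the membership of its index.\<close>
  have walk: "\<exists>A. A \<subseteq> {..<k} \<and> card A \<le> length p \<and> v = u \<otimes> finprod G z A"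
    if "pre_digraph.cas ?D u p v" "set p \<subseteq> arcs ?D" "u \<in> carrier G" for u p v
    using that
  proof (induction p arbitrary: u)
    case Nil
    then show ?case
      by (intro exI[of _ "{}"]) (simp add: pre_digraph.cas.simps)
  next
    case (Cons e p)
    then obtain i where i: "i < k" "head ?D e = u \<otimes> z i"
      using step[of e] by (auto simp: pre_digraph.cas.simps)
    have zi: "z i \<in> carrier G" by (rule z[OF i(1)])
    obtain A where A: "A \<subseteq> {..<k}" "card A \<le> length p" "v = u \<otimes> z i \<otimes> finprod G z A"
      using Cons.IH[of "u \<otimes> z i"] Cons.prems i zi by (auto simp: pre_digraph.cas.simps)
    have finA: "finite A"
      using A(1) finite_subset by blast
    have zA: "z \<in> A \<rightarrow> carrier G"
      using A(1) z by auto
    show ?case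
    proof (cases "i \<in> A")
      case True
      have "finprod G z A = z i \<otimes> finprod G z (A - {i})"
        using finprod_insert[of "A - {i}" i z] finA zA True by (auto simp: insert_absorb)
      moreover have "finprod G z (A - {i}) \<in> carrier G"
        using zA by (intro finprod_closed) auto
      ultimately have "v = u \<otimes> finprod G z (A - {i})"
        using A(3) zi Cons.prems(3) sq[OF zi] by (metis m_assoc m_closed r_one)
      moreover have "card (A - {i}) \<le> length (e # p)"
        using A(2) card_Diff1_le[of A i] by simp
      ultimately show ?thesis
        using A(1) by (intro exI[of _ "A - {i}"]) auto
    next
      case False
      have "finprod G z (insert i A) = z i \<otimes> finprod G z A"
        using finA zA False zi by simp
      moreover have "finprod G z A \<in> carrier G"
        using zA by (rule finprod_closed)
      ultimately have "v = u \<otimes> finprod G z (insert i A)"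
        using A(3) zi Cons.prems(3) by (simp add: m_assoc)
      then show ?thesis
        using A False finA i by (intro exI[of _ "insert i A"]) auto
    qed
  qed
  have "carrier G \<subseteq> finprod G z ` {A. A \<subseteq> {..<k} \<and> card A \<le> r}"
  proof
    fix v assume v: "v \<in> carrier G"
    obtain p where p: "pre_digraph.awalk ?D \<one> p v" "ereal (real (length p)) < ereal (real (Suc r))"
      using graph_diameter_less_awalk[OF wf diam, of \<one> v] v by (auto simp: cayley_graph_def)
    then obtain A where A: "A \<subseteq> {..<k}" "card A \<le> length p" "v = \<one> \<otimes> finprod G z A"
      using walk[of \<one> p v] by (auto simp: pre_digraph.awalk_def)
    moreover have "finprod G z A \<in> carrier G"
      using A(1) z by (intro finprod_closed) auto
    ultimately show "v \<in> finprod G z ` {A. A \<subseteq> {..<k} \<and> card A \<le> r}"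
      using p(2) by auto
  qed
  moreover have "finite {A. A \<subseteq> {..<k} \<and> card A \<le> r}"
    by (rule finite_subset[of _ "Pow {..<k}"]) auto
  ultimately have "card (carrier G) \<le> card {A. A \<subseteq> {..<k} \<and> card A \<le> r}"
    by (rule surj_card_le[rotated])
  then show ?thesis
    by (simp add: order_def card_bounded_subsets)
qed

end

section \<open>Binomial asymptotics\<close>

lemma binomial_Suc_times:
  "real (Suc j) * real (n choose Suc j) = real (n - j) * real (n choose j)"
  by (metis binomial_absorb_comp binomial_absorption of_nat_mult)

lemma binomial_ratio_ge:
  fixes q :: real
  assumes "a \<le> b" "0 \<le> q" "\<And>j. a \<le> j \<Longrightarrow> j < b \<Longrightarrow> q * real (Suc j) \<le> real (n - j)"
  shows "q ^ (b - a) * real (n choose a) \<le> real (n choose b)"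
  using assms(1,3)
proof (induction b rule: dec_induct)
  case (step b)
  have "real (Suc b) * (q ^ (Suc b - a) * real (n choose a))
      = (q * real (Suc b)) * (q ^ (b - a) * real (n choose a))"
    using step.hyps by (simp add: Suc_diff_le)
  also have "\<dots> \<le> real (n - b) * real (n choose b)"
    using step assms(2) by (intro mult_mono) auto
  finally show ?case
    unfolding binomial_Suc_times[symmetric] by (simp only: mult_le_cancel_left_pos of_nat_0_less_iff)
qed simp

lemma binomial_ratio_le:
  fixes q :: real
  assumes "a \<le> b" "0 \<le> q" "\<And>j. a \<le> j \<Longrightarrow> j < b \<Longrightarrow> real (n - j) \<le> q * real (Suc j)"
  shows "real (n choose b) \<le> q ^ (b - a) * real (n choose a)"
  using assms(1,3)
proof (induction b rule: dec_induct)
  case (step b)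
  have "real (Suc b) * real (n choose Suc b) = real (n - b) * real (n choose b)"
    by (rule binomial_Suc_times)
  also have "\<dots> \<le> (q * real (Suc b)) * (q ^ (b - a) * real (n choose a))"
    using step assms(2) by (intro mult_mono) auto
  also have "\<dots> = real (Suc b) * (q ^ (Suc b - a) * real (n choose a))"
    using step.hyps by (simp add: Suc_diff_le)
  finally show ?case
    by (simp only: mult_le_cancel_left_pos of_nat_0_less_iff)
qed simp

text \<open>The two coefficients differ factor by factor: each \<open>n - j\<close> of the falling
  factorial becomes \<open>n - m - j\<close>, which retains at least the share
  \<open>\<theta>\<close>.\<close>

lemma binomial_diff_ge:
  fixes \<theta> :: real
  assumes "0 \<le> \<theta>" "\<And>j. j < r \<Longrightarrow> \<theta> * real (n - j) \<le> real (n - m - j)"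
  shows "\<theta> ^ r * real (n choose r) \<le> real (n - m choose r)"
  using assms(2)
proof (induction r)
  case (Suc r)
  have "real (Suc r) * (\<theta> ^ Suc r * real (n choose Suc r)) = (\<theta> * real (n - r)) * (\<theta> ^ r * real (n choose r))"
    using binomial_Suc_times[of r n] by (simp add: mult_ac)
  also have "\<dots> \<le> real (n - m - r) * real (n - m choose r)"
    using Suc assms(1) by (intro mult_mono) auto
  finally show ?case
    unfolding binomial_Suc_times[symmetric] by (simp only: mult_le_cancel_left_pos of_nat_0_less_iff)
qed simp

lemma two_power_le_central_binomial: "2 ^ n \<le> real (Suc n) * real (n choose (n div 2))"
proof -
  have "real (2 ^ n) = real (\<Sum>j\<le>n. n choose j)"
    by (simp only: choose_row_sum)
  also have "\<dots> \<le> real (\<Sum>j\<le>n. n choose (n div 2))"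
    by (intro of_nat_mono sum_mono binomial_maximum)
  finally show ?thesis by (simp add: algebra_simps)
qed

text \<open>A descent from the middle of the row, where the coefficient is at least
  \<open>2 ^ k / Suc k\<close>: reaching \<open>r\<close> takes about \<open>c * k\<close> levels,
  each losing at most a factor 4. This gives a crude form of the entropy estimate.\<close>

lemma binomial_linear_lower_bound:
  fixes c :: real
  assumes "0 < c" "c \<le> 1 / 8" "r = nat \<lfloor>(1 / 2 - c) * real k\<rfloor>"
  shows "2 powr ((1 - 2 * c) * real k - 2) / real (Suc k) \<le> real (k choose r)"
proof -
  have r: "real r \<le> (1 / 2 - c) * real k" "(1 / 2 - c) * real k - 1 < real r"
    using assms by (auto intro: of_nat_floor)
  have ck: "0 \<le> c * real k" "c * real k \<le> real k / 8"
    using assms mult_right_mono[of c "1/8" "real k"] by auto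
  let ?h = "k div 2"
  have rh: "r \<le> ?h"
  proof -
    have "2 * real r \<le> real k"
      using r(1) ck by (simp add: algebra_simps)
    then show ?thesis by linarith
  qed
  have "2 ^ k \<le> real (Suc k) * real (k choose ?h)"
    by (rule two_power_le_central_binomial)
  also have "real (k choose ?h) \<le> 4 ^ (?h - r) * real (k choose r)"
  proof (rule binomial_ratio_le[OF rh])
    \<comment> \<open>Since \<open>c \<le> 1 / 8\<close>, rounding gives
      \<open>r > 3 / 8 * k - 1\<close>, which makes \<open>4 * Suc j\<close> at least
      \<open>k\<close>.\<close>
    fix j assume "r \<le> j" "j < ?h"
    then have "real k \<le> 4 * real (Suc j)"
      using r(2) ck by (simp add: algebra_simps)
    then show "real (k - j) \<le> 4 * real (Suc j)"
      by linarith
  qed simp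
  also have "(4 :: real) ^ (?h - r) = 2 powr (2 * real (?h - r))"
    by (simp add: powr_realpow[symmetric] powr_powr[symmetric])
  also have "\<dots> \<le> 2 powr (2 * c * real k + 2)"
  proof (intro powr_mono)
    have "real (?h - r) \<le> real k / 2 - real r"
      using rh by linarith
    then show "2 * real (?h - r) \<le> 2 * c * real k + 2"
      using r(2) by (simp add: algebra_simps)
  qed simp
  finally have "2 powr real k \<le> real (Suc k) * (2 powr (2 * c * real k + 2) * real (k choose r))"
    by (simp add: powr_realpow mult_left_mono mult_right_mono)
  then have "2 powr real k / 2 powr (2 * c * real k + 2) \<le> real (Suc k) * real (k choose r)"
    by (simp add: field_simps)
  also have "2 powr real k / 2 powr (2 * c * real k + 2) = 2 powr ((1 - 2 * c) * real k - 2)"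
    by (simp add: powr_diff[symmetric] algebra_simps)
  finally show ?thesis
    by (simp add: field_simps)
qed

text \<open>The hypothesis guarantees that the minimum exists, so that \<open>LEAST\<close> has its
  intended value.\<close>

lemma min_binomial_properties:
  assumes "n \<le> k choose r"
  shows "n \<le> k choose min_binomial k n" "min_binomial k n \<le> r"
    and "j < min_binomial k n \<Longrightarrow> k choose j < n"
  using assms LeastI[of "\<lambda>R. n \<le> k choose R"] Least_le[of "\<lambda>R. n \<le> k choose R"]
    not_less_Least[of j "\<lambda>R. n \<le> k choose R"]
  by (auto simp: min_binomial_def not_le)

text \<open>The regime keeps the critical radius away from the middle layer of the cube.\<close>

lemma generator_regime_bounds:
  assumes reg: "generator_regime k n" and n: "filterlim n at_top sequentially"
  obtains c :: real where "0 < c" "c \<le> 1 / 8"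
    "\<forall>\<^sub>F N in sequentially. n N \<le> 2 ^ k N"
    "\<forall>\<^sub>F N in sequentially. n N \<le> k N choose min_binomial (k N) (n N)
      \<and> real (min_binomial (k N) (n N)) \<le> (1 / 2 - c) * real (k N)
      \<and> (\<forall>j < min_binomial (k N) (n N). k N choose j < n N)"
    "filterlim (\<lambda>N. real (k N)) at_top sequentially"
    "filterlim (\<lambda>N. real (min_binomial (k N) (n N))) at_top sequentially"
proof -
  define R where "R N = min_binomial (k N) (n N)" for N
  have kpos: "k N > 0" for N
    using reg by (simp add: generator_regime_def)
  have lk: "filterlim (\<lambda>N. ln (real (k N))) at_top sequentially"
    and quot: "(\<lambda>N. ln (real (k N)) / ln (real (n N))) \<longlonglongrightarrow> 0"
    and lim: "0 < liminf (\<lambda>N. ereal ((real (k N) - log 2 (real (n N))) / real (k N)))"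
    using reg by (auto simp: generator_regime_def)
  have "filterlim (\<lambda>N. exp (ln (real (k N)))) at_top sequentially"
    by (rule filterlim_compose[OF exp_at_top lk])
  then have k: "filterlim (\<lambda>N. real (k N)) at_top sequentially"
    by (simp add: kpos)
  have npos: "\<forall>\<^sub>F N in sequentially. n N \<ge> 2"
    using n by (simp add: filterlim_at_top)
  obtain \<delta>0 where d0: "0 < \<delta>0" "ereal \<delta>0 < liminf (\<lambda>N. ereal ((real (k N) - log 2 (real (n N))) / real (k N)))"
    using ereal_dense2[OF lim] by auto
  \<comment> \<open>The cap 1/2 makes \<open>c = \<delta> / 4\<close> at most 1/8, as
    \<open>binomial_linear_lower_bound\<close> demands.\<close>
  define \<delta> where "\<delta> = min \<delta>0 (1 / 2)"
  have \<delta>: "0 < \<delta>" "\<delta> \<le> 1 / 2" "\<delta> \<le> \<delta>0"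
    using d0 by (auto simp: \<delta>_def)
  define c where "c = \<delta> / 4"
  have c: "0 < c" "c \<le> 1 / 8"
    using \<delta> by (auto simp: c_def)
  have "\<forall>\<^sub>F N in sequentially. ereal \<delta>0 < ereal ((real (k N) - log 2 (real (n N))) / real (k N))"
    by (rule less_LiminfD[OF d0(2)])
  with npos have nle: "\<forall>\<^sub>F N in sequentially. real (n N) \<le> 2 powr ((1 - \<delta>) * real (k N))"
  proof eventually_elim
    case (elim N)
    have "\<delta> * real (k N) \<le> \<delta>0 * real (k N)"
      using \<delta> by (intro mult_right_mono) auto
    also have "\<dots> < real (k N) - log 2 (real (n N))"
      using elim kpos[of N] by (simp add: field_simps)
    finally have "log 2 (real (n N)) \<le> (1 - \<delta>) * real (k N)"
      by (simp add: algebra_simps)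
    then show ?case
      using elim by (simp add: log_le_iff)
  qed
  have n2: "\<forall>\<^sub>F N in sequentially. n N \<le> 2 ^ k N"
    using nle
  proof eventually_elim
    case (elim N)
    also have "2 powr ((1 - \<delta>) * real (k N)) \<le> 2 powr real (k N)"
      using \<delta> by (intro powr_mono) (auto simp: mult_left_le_one_le)
    finally have "real (n N) \<le> real (2 ^ k N)"
      by (simp add: powr_realpow)
    then show ?case
      by (simp only: of_nat_le_iff)
  qed
  \<comment> \<open>Of the margin \<open>\<delta> = 4 * c\<close>, one half keeps the radius away
    from \<open>k / 2\<close> and the other absorbs the polynomial factor in
    \<open>binomial_linear_lower_bound\<close>.\<close>
  have "\<forall>\<^sub>F x in at_top. 4 * (x + 1) \<le> 2 powr (2 * c * x)"
    using c by real_asymp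
  then have big: "\<forall>\<^sub>F N in sequentially. 4 * (real (k N) + 1) \<le> 2 powr (2 * c * real (k N))"
    using k by (rule eventually_compose_filterlim)
  have R: "\<forall>\<^sub>F N in sequentially. n N \<le> k N choose R N
      \<and> real (R N) \<le> (1 / 2 - c) * real (k N) \<and> (\<forall>j < R N. k N choose j < n N)"
    using nle big
  proof eventually_elim
    case (elim N)
    define r where "r = nat \<lfloor>(1 / 2 - c) * real (k N)\<rfloor>"
    have "real (n N) \<le> 2 powr ((1 - 4 * c) * real (k N))"
      using elim by (simp add: c_def)
    also have "\<dots> \<le> 2 powr ((1 - 2 * c) * real (k N) - 2) / real (Suc (k N))"
    proof -
      have "2 powr ((1 - 4 * c) * real (k N)) * (4 * (real (k N) + 1))
          \<le> 2 powr ((1 - 4 * c) * real (k N)) * 2 powr (2 * c * real (k N))"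
        using elim by (intro mult_left_mono) auto
      also have "\<dots> = 2 powr ((1 - 2 * c) * real (k N))"
        by (simp add: powr_add[symmetric] algebra_simps)
      also have "\<dots> = 4 * 2 powr ((1 - 2 * c) * real (k N) - 2)"
        by (simp add: powr_diff)
      finally show ?thesis
        by (simp add: field_simps)
    qed
    also have "\<dots> \<le> real (k N choose r)"
      by (rule binomial_linear_lower_bound[OF c r_def])
    finally have "n N \<le> k N choose r"
      by (simp only: of_nat_le_iff)
    note mb = min_binomial_properties[OF this]
    have "real r \<le> (1 / 2 - c) * real (k N)"
      unfolding r_def using c by (intro of_nat_floor) auto
    then show ?case
      using mb unfolding R_def by (meson of_nat_mono order_trans)
  qed
  \<comment> \<open>From \<open>n \<le> k choose R \<le> k ^ R\<close> one gets
    \<open>R \<ge> ln n / ln k\<close>, and this quotient diverges by the last condition of the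
    regime.\<close>
  have "filterlim (\<lambda>N. inverse (ln (real (k N)) / ln (real (n N)))) at_top sequentially"
  proof (rule filterlim_inverse_at_top[OF quot])
    have "\<forall>\<^sub>F N in sequentially. 0 < ln (real (k N))"
      using lk by (simp add: filterlim_at_top_dense)
    with npos show "\<forall>\<^sub>F N in sequentially. 0 < ln (real (k N)) / ln (real (n N))"
      by eventually_elim auto
  qed
  moreover have "\<forall>\<^sub>F N in sequentially. inverse (ln (real (k N)) / ln (real (n N))) \<le> real (R N)"
  proof -
    have "\<forall>\<^sub>F N in sequentially. 0 < ln (real (k N))"
      using lk by (simp add: filterlim_at_top_dense)
    with npos R show ?thesis
    proof eventually_elim
      case (elim N)
      have "R N \<le> k N"
        using elim(2) c mult_right_mono[of "1 / 2 - c" 1 "real (k N)"] by linarith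
      then have "n N \<le> k N ^ R N"
        using elim(2) binomial_le_pow le_trans by blast
      then have "real (n N) \<le> real (k N) ^ R N"
        by (simp only: of_nat_power[symmetric] of_nat_le_iff)
      then have "ln (real (n N)) \<le> ln (real (k N) ^ R N)"
        using elim(1) kpos[of N] by (subst ln_le_cancel_iff) auto
      then show ?case
        using elim kpos[of N] by (simp add: ln_realpow field_simps)
    qed
  qed
  ultimately have "filterlim (\<lambda>N. real (R N)) at_top sequentially"
    by (rule filterlim_at_top_mono)
  then show thesis
    using that[OF c n2 _ k] R by (simp add: R_def)
qed

text \<open>A trade-off: rising from \<open>R\<close> to \<open>L\<close> gains a factor
  \<open>1 + c\<close> per level, as all these levels stay clear of the middle, while deleting
  \<open>m\<close> generators costs at most \<open>(1 + c) powr (e / 4)\<close> for each of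
  \<open>R\<close> factors. The \<open>- 1\<close> in \<open>L\<close> leaves room for the step with
  a reserved generator.\<close>

lemma binomial_supercritical:
  fixes c e \<eta> :: real
  assumes c: "0 < c" "c \<le> 1 / 8" and e: "0 < e" "e \<le> c"
    and \<eta>: "0 < \<eta>" "\<eta> \<le> c / 4" "\<eta> \<le> (1 - (1 + c) powr (- e / 4)) / 2"
    and n: "n \<le> k choose R" and R: "real R \<le> (1 / 2 - c) * real k" "8 \<le> e * real R"
    and m: "real m \<le> \<eta> * real k" and L: "L = R + nat \<lfloor>e * real R\<rfloor> - 1"
  shows "real n * (1 + c) powr (e * real R / 2) \<le> real (k - m choose L)"
    and "0 < L" "L \<le> k - m" "real (L + 1) \<le> (1 + e) * real R"
proof -
  have fl: "real (nat \<lfloor>e * real R\<rfloor>) \<le> e * real R" "e * real R - 1 < real (nat \<lfloor>e * real R\<rfloor>)"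
    using R e by (auto intro: of_nat_floor)
  have "1 < real (nat \<lfloor>e * real R\<rfloor>)"
    using fl(2) R(2) by linarith
  then have RL: "R < L"
    unfolding L by linarith
  then show "0 < L" by simp
  have L1: "real (L + 1) = real R + real (nat \<lfloor>e * real R\<rfloor>)"
    using RL by (simp add: L)
  then show Lle: "real (L + 1) \<le> (1 + e) * real R"
    using fl(1) by (simp add: algebra_simps)
  define x where "x = real k"
  have x: "x \<ge> 0" by (simp add: x_def)
  have mx: "real m \<le> c * x / 4" "real m \<le> (1 - (1 + c) powr (- e / 4)) / 2 * x"
    using m \<eta> mult_right_mono[OF \<eta>(2) x] mult_right_mono[OF \<eta>(3) x] by (auto simp: x_def)
  have Rx: "real R \<le> x / 2 - c * x" "R > 0"
    using R by (auto simp: x_def algebra_simps intro: gr0I)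
  have cx: "0 \<le> c * x" "0 \<le> c * c * x" "c * x \<le> x / 8"
    using c x mult_right_mono[of c "1/8" x] by auto
  \<comment> \<open>The level \<open>L\<close> still lies \<open>c * k / 2\<close> below the middle,
    because \<open>(1 + c) * (1 / 2 - c) \<le> 1 / 2 - c / 2\<close>.\<close>
  have Lx: "real L + 1 \<le> x / 2 - c * x / 2"
  proof -
    have "real L + 1 \<le> (1 + c) * (x / 2 - c * x)"
      using Lle e Rx c by (smt (verit, best) mult_mono of_nat_0_le_iff of_nat_Suc Suc_eq_plus1)
    also have "\<dots> \<le> x / 2 - c * x / 2"
      using cx by (simp add: algebra_simps)
    finally show ?thesis .
  qed
  show LK: "L \<le> k - m"
    using Lx mx cx by (simp add: x_def)
  have "real n * (1 + c) powr (e * real R / 2)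
      \<le> real n * ((1 + c) ^ (L - R) * ((1 + c) powr (- e / 4)) ^ R)"
  proof (intro mult_left_mono)
    have "(1 + c) powr (e * real R / 2) \<le> (1 + c) powr (real (L - R) + - e / 4 * real R)"
    proof (intro powr_mono)
      have "real (L - R) = real L - real R"
        using RL by (simp add: of_nat_diff)
      \<comment> \<open>The number of levels gained is at least \<open>e * R - 2\<close> and the
        deletion costs \<open>e * R / 4\<close>; at least \<open>e * R / 2\<close> remains because
        \<open>e * R \<ge> 8\<close>.\<close>
      then show "e * real R / 2 \<le> real (L - R) + - e / 4 * real R"
        using fl R(2) L1 by linarith
    qed (use c in simp)
    also have "\<dots> = (1 + c) ^ (L - R) * ((1 + c) powr (- e / 4)) ^ R"
    proof -
      have "((1 + c) powr (- e / 4)) ^ R = (1 + c) powr (- e / 4 * real R)"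
        using c by (simp add: powr_realpow[symmetric] powr_powr)
      then show ?thesis
        using c by (simp only: powr_add) (simp add: powr_realpow)
    qed
    finally show "(1 + c) powr (e * real R / 2) \<le> (1 + c) ^ (L - R) * ((1 + c) powr (- e / 4)) ^ R" .
  qed simp
  also have "\<dots> = (1 + c) ^ (L - R) * (((1 + c) powr (- e / 4)) ^ R * real n)"
    by simp
  also have "\<dots> \<le> (1 + c) ^ (L - R) * (((1 + c) powr (- e / 4)) ^ R * real (k choose R))"
    using c n by (intro mult_left_mono) auto
  also have "\<dots> \<le> (1 + c) ^ (L - R) * real (k - m choose R)"
  proof (intro mult_left_mono binomial_diff_ge)
    fix j assume j: "j < R"
    define \<theta> where "\<theta> = (1 + c) powr (- e / 4)"
    have \<theta>: "\<theta> < 1"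
      using \<eta> by (simp add: \<theta>_def)
    \<comment> \<open>Every \<open>j < R\<close> is below the middle, so \<open>k - j\<close> is at
      least \<open>k / 2\<close> and deleting \<open>m\<close> elements removes at most the share
      \<open>1 - \<theta>\<close> of it.\<close>
    have "(1 - \<theta>) * (x / 2) \<le> (1 - \<theta>) * (x - real j)"
      using \<theta> j Rx cx by (intro mult_left_mono) auto
    then have "real m \<le> (1 - \<theta>) * (x - real j)"
      using mx unfolding \<theta>_def by simp
    then show "(1 + c) powr (- e / 4) * real (k - j) \<le> real (k - m - j)"
      using j RL LK unfolding \<theta>_def[symmetric] by (simp add: x_def algebra_simps of_nat_diff)
  qed (use c in auto)
  also have "\<dots> \<le> real (k - m choose L)"
  proof (rule binomial_ratio_ge)
    fix j assume "R \<le> j" "j < L"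
    then have "real (Suc j) \<le> real L" by simp
    then have "(1 + c) * real (Suc j) \<le> (1 + c) * (x / 2 - c * x / 2)"
      using c Lx by (intro mult_left_mono) auto
    also have "\<dots> \<le> x / 2"
      using cx by (simp add: algebra_simps)
    also have "\<dots> \<le> real (k - m - j)"
      using \<open>j < L\<close> LK Lx mx cx by (simp add: x_def of_nat_diff)
    finally show "(1 + c) * real (Suc j) \<le> real (k - m - j)" .
  qed (use RL c in auto)
  finally show "real n * (1 + c) powr (e * real R / 2) \<le> real (k - m choose L)" .
qed

text \<open>Below \<open>R\<close> the coefficients grow by a factor \<open>1 + c\<close> per level.
  The sum is therefore at most \<open>r + 1\<close> times its last term, while the coefficient at
  \<open>R - 1\<close>, still smaller than \<open>n\<close>, exceeds that term exponentially. For
  large \<open>R\<close> the conclusion is false, so it serves to refute the hypothesis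
  \<open>sum\<close>.\<close>

lemma binomial_subcritical:
  fixes c e :: real
  assumes c: "0 < c" "c \<le> 1 / 8" and e: "0 < e" "e < 1"
    and R: "real R \<le> (1 / 2 - c) * real k" "8 \<le> e * real R"
    and n: "k choose (R - 1) < n" and r: "r = nat \<lfloor>(1 - e) * real R\<rfloor>"
    and sum: "n \<le> (\<Sum>j\<le>r. k choose j)"
  shows "(1 + c) powr (e * real R / 2) \<le> real R + 1"
proof -
  have "real r \<le> (1 - e) * real R"
    using e unfolding r by (intro of_nat_floor) auto
  then have rle: "real r \<le> real R - e * real R"
    by (simp add: algebra_simps)
  then have rR: "r < R - 1"
    using R by linarith
  have ratio: "(1 + c) ^ (b - a) * real (k choose a) \<le> real (k choose b)"
    if "a \<le> b" "b < R" for a b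
  proof (rule binomial_ratio_ge[OF that(1)])
    fix j assume "a \<le> j" "j < b"
    then have j: "real (Suc j) \<le> (1 / 2 - c) * real k"
      using that R(1) by linarith
    then have "(1 + c) * real (Suc j) \<le> (1 + c) * ((1 / 2 - c) * real k)"
      using c by (intro mult_left_mono) auto
    also have "\<dots> \<le> real k / 2"
      using c by (simp add: algebra_simps)
    also have "\<dots> \<le> real (k - j)"
    proof -
      have "real (Suc j) \<le> real k / 2 - c * real k" "0 \<le> c * real k"
        using j c by (simp_all add: algebra_simps)
      then show ?thesis by linarith
    qed
    finally show "(1 + c) * real (Suc j) \<le> real (k - j)" .
  qed (use c in simp)
  have rk: "0 < real (k choose r)"
  proof -
    have "real R \<le> real k"
      using R(1) c mult_right_mono[of "1 / 2 - c" 1 "real k"] by simp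
    then show ?thesis using rR by simp
  qed
  have "(1 + c) powr (e * real R / 2) * real (k choose r) \<le> (1 + c) ^ (R - 1 - r) * real (k choose r)"
  proof (intro mult_right_mono)
    \<comment> \<open>Rounding down gives \<open>R - 1 - r \<ge> e * R - 1\<close>, and
      \<open>e * R \<ge> 8\<close> makes this at least half of \<open>e * R\<close>.\<close>
    have "e * real R / 2 \<le> real (R - 1 - r)"
      using rle rR R(2) by (simp add: of_nat_diff)
    then have "(1 + c) powr (e * real R / 2) \<le> (1 + c) powr real (R - 1 - r)"
      using c by (intro powr_mono) auto
    then show "(1 + c) powr (e * real R / 2) \<le> (1 + c) ^ (R - 1 - r)"
      using c by (simp add: powr_realpow)
  qed simp
  also have "\<dots> \<le> real (k choose (R - 1))"
    using rR by (intro ratio) auto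
  also have "\<dots> \<le> real (\<Sum>j\<le>r. k choose j)"
    using n sum by (intro of_nat_mono) linarith
  also have "\<dots> \<le> (\<Sum>j\<le>r. real (k choose r))"
  proof (unfold of_nat_sum, rule sum_mono)
    fix j assume "j \<in> {..r}"
    moreover from this have "1 * real (k choose j) \<le> (1 + c) ^ (r - j) * real (k choose j)"
      using c by (intro mult_right_mono one_le_power) auto
    ultimately show "real (k choose j) \<le> real (k choose r)"
      using ratio[of j r] rR by fastforce
  qed
  also have "\<dots> = (real r + 1) * real (k choose r)"
    by simp
  finally have "(1 + c) powr (e * real R / 2) \<le> real r + 1"
    using rk by (simp only: mult_le_cancel_right_pos)
  then show ?thesis
    using rR by simp
qed

section \<open>Concentration of the diameter\<close>

text \<open>The two error terms of \<open>prob_diameter_cayley_digraph\<close> decay exponentially,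
  the second-moment term in the radius and the term of the reserved generators in
  \<open>k\<close>.\<close>

lemma diameter_upper_bound:
  fixes G :: "nat \<Rightarrow> ('a, 'b) monoid_scheme"
  assumes G: "\<And>N. group (G N)" "\<And>N. finite (carrier (G N))"
    and n: "filterlim (\<lambda>N. order (G N)) at_top sequentially"
    and reg: "generator_regime k (\<lambda>N. order (G N))" and \<epsilon>: "\<epsilon> > 0"
  shows "(\<lambda>N. measure_pmf.prob (random_generators (G N) (k N))
      {z. \<not> graph_diameter (cayley_digraph (G N) (k N) z)
        \<le> ereal ((1 + \<epsilon>) * real (min_binomial (k N) (order (G N))))}) \<longlonglongrightarrow> 0"
proof -
  define R where "R N = min_binomial (k N) (order (G N))" for N
  obtain c :: real where c: "0 < c" "c \<le> 1 / 8"
    and n2: "\<forall>\<^sub>F N in sequentially. order (G N) \<le> 2 ^ k N"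
    and R: "\<forall>\<^sub>F N in sequentially. order (G N) \<le> k N choose R N
      \<and> real (R N) \<le> (1 / 2 - c) * real (k N) \<and> (\<forall>j < R N. k N choose j < order (G N))"
    and k: "filterlim (\<lambda>N. real (k N)) at_top sequentially"
    and Rlim: "filterlim (\<lambda>N. real (R N)) at_top sequentially"
    using generator_regime_bounds[OF reg n] by (auto simp: R_def)
  \<comment> \<open>Shrinking \<open>\<epsilon>\<close> to \<open>e\<close> only strengthens the
    bound; the caps on \<open>e\<close> and on \<open>\<eta>\<close> are those required by
    \<open>binomial_supercritical\<close>.\<close>
  define e where "e = min \<epsilon> c"
  have e: "0 < e" "e \<le> c" "e \<le> \<epsilon>"
    using \<epsilon> c by (auto simp: e_def)
  define \<eta> where "\<eta> = min (c / 4) ((1 - (1 + c) powr (- e / 4)) / 2)"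
  have "(1 + c) powr (- e / 4) < 1"
    using c e powr_less_mono[of "- e / 4" 0 "1 + c"] by simp
  then have \<eta>: "0 < \<eta>" "\<eta> \<le> c / 4" "\<eta> \<le> (1 - (1 + c) powr (- e / 4)) / 2"
    using c unfolding \<eta>_def by (simp_all only: min_less_iff_conj min.cobounded1 min.cobounded2) simp_all
  \<comment> \<open>so that \<open>\<beta>\<close> to the power \<open>\<eta> * k\<close> is \<open>exp (- 2 * k)\<close>, which beats the order \<open>\<le> 2 ^ k\<close>\<close>
  define \<beta> where "\<beta> = exp (- 2 / \<eta>)"
  have \<beta>: "0 < \<beta>" by (simp add: \<beta>_def)
  define B where "B N = 1 / \<beta> * (1 + c) powr (- e / 2 * real (R N)) + exp (2 / \<eta>) * exp (- real (k N))" for N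
  have B: "B \<longlonglongrightarrow> 0"
  proof -
    have "((\<lambda>x. (1 + c) powr (- e / 2 * x)) \<longlongrightarrow> 0) at_top"
      using c e by real_asymp
    then have 1: "(\<lambda>N. (1 + c) powr (- e / 2 * real (R N))) \<longlonglongrightarrow> 0"
      using Rlim by (rule filterlim_compose)
    have "((\<lambda>x::real. exp (- x)) \<longlongrightarrow> 0) at_top"
      by real_asymp
    then have 2: "(\<lambda>N. exp (- real (k N))) \<longlonglongrightarrow> 0"
      using k by (rule filterlim_compose)
    show ?thesis
      unfolding B_def
      using tendsto_add[OF tendsto_mult_left[OF 1, of "1 / \<beta>"] tendsto_mult_left[OF 2, of "exp (2 / \<eta>)"]]
      by simp
  qed
  have "\<forall>\<^sub>F N in sequentially. 8 / e \<le> real (R N)"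
    using Rlim by (simp add: filterlim_at_top)
  with n2 R have "\<forall>\<^sub>F N in sequentially.
      measure_pmf.prob (random_generators (G N) (k N))
        {z. \<not> graph_diameter (cayley_digraph (G N) (k N) z) \<le> ereal ((1 + \<epsilon>) * real (R N))} \<le> B N"
  proof eventually_elim
    case (elim N)
    interpret group "G N" by (rule G)
    define n where "n = real (order (G N))"
    have n: "n > 0"
      using G(2)[of N] by (simp add: n_def order_gt_0_iff_finite)
    define m where "m = nat \<lfloor>\<eta> * real (k N)\<rfloor>"
    define L where "L = R N + nat \<lfloor>e * real (R N)\<rfloor> - 1"
    have m: "real m \<le> \<eta> * real (k N)" "\<eta> * real (k N) - 1 \<le> real m"
      using \<eta> unfolding m_def by (auto intro: of_nat_floor)
    have "8 \<le> e * real (R N)"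
      using elim(3) e by (simp add: field_simps)
    note super = binomial_supercritical[OF c e(1,2) \<eta> _ _ this m(1) L_def, of "order (G N)"]
    have LK: "0 < L" "L \<le> k N - m" "real (L + 1) \<le> (1 + e) * real (R N)"
      and M: "n * (1 + c) powr (e * real (R N) / 2) \<le> real (k N - m choose L)"
      using super elim(2) by (auto simp: n_def)
    have "m < k N"
      using LK by linarith
    then have km: "k N - m + m = k N" by simp
    have "real (L + 1) \<le> (1 + \<epsilon>) * real (R N)"
      using LK(3) e(3) mult_right_mono[of "1 + e" "1 + \<epsilon>" "real (R N)"] by linarith
    then have "x \<le> ereal ((1 + \<epsilon>) * real (R N))" if "x \<le> ereal (real (L + 1))" for x
      using that ereal_less_eq(3) order.trans by blast
    then have "measure_pmf.prob (random_generators (G N) (k N))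
        {z. \<not> graph_diameter (cayley_digraph (G N) (k N) z) \<le> ereal ((1 + \<epsilon>) * real (R N))}
      \<le> measure_pmf.prob (random_generators (G N) (k N))
        {z. \<not> graph_diameter (cayley_digraph (G N) (k N) z) \<le> ereal (real (L + 1))}"
      by (intro measure_pmf.finite_measure_mono Collect_mono) auto
    also have "\<dots> \<le> n / (\<beta> * real (k N - m choose L)) + n * \<beta> ^ m"
      using prob_diameter_cayley_digraph[OF G(2) LK(1,2) \<beta>, of m] by (simp add: km n_def)
    also have "\<dots> \<le> B N"
      unfolding B_def
    proof (rule add_mono)
      have pos: "0 < \<beta> * (n * (1 + c) powr (e * real (R N) / 2))"
        using \<beta> n c by simp
      have "n / (\<beta> * real (k N - m choose L)) \<le> n / (\<beta> * (n * (1 + c) powr (e * real (R N) / 2)))"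
        using M \<beta> n pos LK(2) by (intro divide_left_mono mult_left_mono mult_pos_pos) auto
      also have "\<dots> = 1 / \<beta> * (1 + c) powr (- e / 2 * real (R N))"
        using n by (simp add: powr_minus field_simps)
      finally show "n / (\<beta> * real (k N - m choose L)) \<le> 1 / \<beta> * (1 + c) powr (- e / 2 * real (R N))" .
    next
      have "n \<le> 2 ^ k N"
        using elim(1) unfolding n_def by (metis of_nat_le_iff of_nat_numeral of_nat_power)
      also have "\<dots> \<le> exp 1 ^ k N"
        using exp_ge_add_one_self[of 1] by (intro power_mono) auto
      also have "\<dots> = exp (real (k N))"
        by (simp add: exp_of_nat_mult[symmetric])
      finally have "n \<le> exp (real (k N))" .
      \<comment> \<open>Since \<open>m\<close> is at least \<open>\<eta> * k - 1\<close>, rounding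
        costs only the constant factor \<open>exp (2 / \<eta>)\<close>.\<close>
      moreover have "\<beta> ^ m \<le> exp (2 / \<eta> - 2 * real (k N))"
      proof -
        have "\<beta> ^ m = exp (- 2 / \<eta> * real m)"
          by (simp add: \<beta>_def exp_of_nat_mult[symmetric] mult.commute)
        also have "- 2 / \<eta> * real m \<le> - 2 / \<eta> * (\<eta> * real (k N) - 1)"
          using \<eta> m(2) by (intro mult_left_mono_neg) auto
        also have "\<dots> = 2 / \<eta> - 2 * real (k N)"
          using \<eta> by (simp add: field_simps)
        finally show ?thesis by simp
      qed
      ultimately have "n * \<beta> ^ m \<le> exp (real (k N)) * exp (2 / \<eta> - 2 * real (k N))"
        using \<beta> by (intro mult_mono) auto
      also have "\<dots> = exp (2 / \<eta>) * exp (- real (k N))"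
        by (simp add: exp_add[symmetric])
      finally show "n * \<beta> ^ m \<le> exp (2 / \<eta>) * exp (- real (k N))" .
    qed
    finally show ?case .
  qed
  then show ?thesis
    unfolding R_def[symmetric]
    by (intro tendsto_sandwich[OF _ _ tendsto_const B]) auto
qed

lemma AE_random_generators:
  assumes "group G" "finite (carrier G)"
  shows "AE z in measure_pmf (random_generators G k). \<forall>i<k. z i \<in> carrier G"
  using assms group.set_uniform_tuple[OF assms, of "{..<k}"]
  by (auto simp: AE_measure_pmf_iff random_generators_def PiE_dflt_def)

text \<open>Counting works for every choice of generators, so the bound is deterministic. It
  concerns the undirected graph, whose diameter is the smaller one.\<close>

lemma diameter_lower_bound:
  fixes G :: "nat \<Rightarrow> ('a, 'b) monoid_scheme"
  assumes G: "\<And>N. comm_group (G N)" "\<And>N. finite (carrier (G N))"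
    and sq: "\<And>N x. x \<in> carrier (G N) \<Longrightarrow> x \<otimes>\<^bsub>G N\<^esub> x = \<one>\<^bsub>G N\<^esub>"
    and n: "filterlim (\<lambda>N. order (G N)) at_top sequentially"
    and reg: "generator_regime k (\<lambda>N. order (G N))" and \<epsilon>: "\<epsilon> > 0"
  shows "\<forall>\<^sub>F N in sequentially. \<forall>z. (\<forall>i<k N. z i \<in> carrier (G N)) \<longrightarrow>
    ereal ((1 - \<epsilon>) * real (min_binomial (k N) (order (G N)))) < graph_diameter (cayley_graph (G N) (k N) z)"
proof -
  define R where "R N = min_binomial (k N) (order (G N))" for N
  obtain c :: real where c: "0 < c" "c \<le> 1 / 8"
    and R: "\<forall>\<^sub>F N in sequentially. order (G N) \<le> k N choose R N
      \<and> real (R N) \<le> (1 / 2 - c) * real (k N) \<and> (\<forall>j < R N. k N choose j < order (G N))"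
    and Rlim: "filterlim (\<lambda>N. real (R N)) at_top sequentially"
    using generator_regime_bounds[OF reg n] by (auto simp: R_def)
  \<comment> \<open>The cap 1/2 keeps \<open>1 - e\<close> positive even for large
    \<open>\<epsilon>\<close>; the bound with \<open>e\<close> implies the one with
    \<open>\<epsilon>\<close>.\<close>
  define e where "e = min \<epsilon> (1 / 2)"
  have e: "0 < e" "e < 1" "e \<le> \<epsilon>"
    using \<epsilon> by (auto simp: e_def)
  have "\<forall>\<^sub>F x in at_top. x + 1 < (1 + c) powr (e * x / 2)"
    using c e by real_asymp
  then have "\<forall>\<^sub>F N in sequentially. real (R N) + 1 < (1 + c) powr (e * real (R N) / 2)"
    using Rlim by (rule eventually_compose_filterlim)
  moreover have "\<forall>\<^sub>F N in sequentially. 8 / e \<le> real (R N)"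
    using Rlim by (simp add: filterlim_at_top)
  ultimately show ?thesis
    using R unfolding R_def[symmetric]
  proof (eventually_elim, intro allI impI)
    fix N z
    assume gap: "real (R N) + 1 < (1 + c) powr (e * real (R N) / 2)" and R8: "8 / e \<le> real (R N)"
      and RN: "order (G N) \<le> k N choose R N \<and> real (R N) \<le> (1 / 2 - c) * real (k N)
        \<and> (\<forall>j < R N. k N choose j < order (G N))"
      and z: "\<forall>i<k N. z i \<in> carrier (G N)"
    interpret comm_group "G N" by (rule G)
    define r where "r = nat \<lfloor>(1 - e) * real (R N)\<rfloor>"
    have R8': "8 \<le> e * real (R N)" "R N > 0"
      using R8 e by (auto simp: field_simps intro: gr0I)
    show "ereal ((1 - \<epsilon>) * real (R N)) < graph_diameter (cayley_graph (G N) (k N) z)"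
    proof (rule ccontr)
      assume "\<not> ?thesis"
      then have "graph_diameter (cayley_graph (G N) (k N) z) \<le> ereal ((1 - \<epsilon>) * real (R N))"
        by simp
      \<comment> \<open>With \<open>r\<close> a floor, the assumed bound on the diameter is strictly
        below \<open>Suc r\<close>, the form used by
        \<open>order_le_if_cayley_graph_diameter\<close>.\<close>
      also have "(1 - \<epsilon>) * real (R N) < real (Suc r)"
      proof -
        have "(1 - \<epsilon>) * real (R N) \<le> (1 - e) * real (R N)"
          using e by (intro mult_right_mono) auto
        also have "\<dots> < real (Suc r)"
          unfolding r_def by linarith
        finally show ?thesis .
      qed
      finally have "graph_diameter (cayley_graph (G N) (k N) z) < ereal (real (Suc r))"
        by simp
      then have "order (G N) \<le> (\<Sum>j\<le>r. k N choose j)"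
        using G(2) z sq by (intro order_le_if_cayley_graph_diameter) auto
      then have "(1 + c) powr (e * real (R N) / 2) \<le> real (R N) + 1"
        using RN R8'
        by (intro binomial_subcritical[OF c e(1,2) _ _ _ r_def, of "k N" "order (G N)"]) auto
      then show False
        using gap by simp
    qed
  qed
qed

section \<open>Elementary abelian 2-groups and the final assembly\<close>

lemma comm_group_Z2_power: "comm_group (Z2_power d)"
proof (rule group.group_comm_groupI[OF group_Z2_power])
  show "x \<otimes>\<^bsub>Z2_power d\<^esub> y = y \<otimes>\<^bsub>Z2_power d\<^esub> x" for x y
    by (simp add: Z2_power_def integer_mod_group_def add.commute)
qed

lemma Z2_power_square: "x \<otimes>\<^bsub>Z2_power d\<^esub> x = \<one>\<^bsub>Z2_power d\<^esub>"
proof -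
  have "x i \<otimes>\<^bsub>integer_mod_group 2\<^esub> x i = \<one>\<^bsub>integer_mod_group 2\<^esub>" for i
    by simp
  then show ?thesis
    by (simp add: Z2_power_def)
qed

lemma finite_Z2_power: "finite (carrier (Z2_power d))"
  using order_Z2_power[of d] by (simp add: order_def card_ge_0_finite)

text \<open>The two bounds force \<open>x\<close> to be finite, which turns the quotient into one of
  real numbers.\<close>

lemma ereal_ratio_deviation:
  fixes x :: ereal
  assumes "0 < R" "ereal ((1 - \<epsilon>) * R) < x" "x \<le> ereal ((1 + \<epsilon>) * R)"
  shows "\<not> \<bar>x / ereal R - 1\<bar> > ereal \<epsilon>"
proof -
  obtain y where y: "x = ereal y"
    using assms by (cases x) auto
  then have "1 - \<epsilon> < y / R" "y / R \<le> 1 + \<epsilon>"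
    using assms by (auto simp: field_simps)
  then have "\<bar>y / R - 1\<bar> \<le> \<epsilon>"
    by (simp add: abs_le_iff)
  then show ?thesis
    using y assms(1) by (simp add: one_ereal_def)
qed

theorem theorem4:
  fixes G :: "nat \<Rightarrow> 'a monoid" and k :: "nat \<Rightarrow> nat"
    and d :: "nat \<Rightarrow> nat" and l :: "nat \<Rightarrow> nat"
  shows
    "((\<forall>N. group (G N) \<and> finite (carrier (G N))) \<longrightarrow>
      filterlim (\<lambda>N. order (G N)) at_top sequentially \<longrightarrow>
      generator_regime k (\<lambda>N. order (G N)) \<longrightarrow>
      (\<forall>\<epsilon>::real. \<epsilon> > 0 \<longrightarrow>
        (\<lambda>N. measure_pmf.prob (random_generators (G N) (k N))
           {z. graph_diameter (cayley_digraph (G N) (k N) z)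
                 \<le> ereal ((1 + \<epsilon>) * real (min_binomial (k N) (order (G N))))})
          \<longlonglongrightarrow> 1 \<and>
        (\<lambda>N. measure_pmf.prob (random_generators (G N) (k N))
           {z. graph_diameter (cayley_graph (G N) (k N) z)
                 \<le> ereal ((1 + \<epsilon>) * real (min_binomial (k N) (order (G N))))})
          \<longlonglongrightarrow> 1))
     \<and>
     (filterlim d at_top sequentially \<longrightarrow>
      generator_regime l (\<lambda>N. 2 ^ d N) \<longrightarrow>
      (\<forall>\<epsilon>::real. \<epsilon> > 0 \<longrightarrow>
        (\<lambda>N. measure_pmf.prob (random_generators (Z2_power (d N)) (l N))
           {z. \<bar>graph_diameter (cayley_digraph (Z2_power (d N)) (l N) z)
                   / ereal (real (min_binomial (l N) (2 ^ d N))) - 1\<bar> > ereal \<epsilon>})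
          \<longlonglongrightarrow> 0 \<and>
        (\<lambda>N. measure_pmf.prob (random_generators (Z2_power (d N)) (l N))
           {z. \<bar>graph_diameter (cayley_graph (Z2_power (d N)) (l N) z)
                   / ereal (real (min_binomial (l N) (2 ^ d N))) - 1\<bar> > ereal \<epsilon>})
          \<longlonglongrightarrow> 0))"
proof (intro conjI impI allI)
  fix \<epsilon> :: real
  assume G: "\<forall>N. group (G N) \<and> finite (carrier (G N))"
    and n: "filterlim (\<lambda>N. order (G N)) at_top sequentially"
    and reg: "generator_regime k (\<lambda>N. order (G N))" and \<epsilon>: "\<epsilon> > 0"
  have GN: "group (G N)" "finite (carrier (G N))" for N
    using G by auto
  let ?b = "\<lambda>N. ereal ((1 + \<epsilon>) * real (min_binomial (k N) (order (G N))))"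
  let ?D = "\<lambda>N. {z. graph_diameter (cayley_digraph (G N) (k N) z) \<le> ?b N}"
  let ?U = "\<lambda>N. {z. graph_diameter (cayley_graph (G N) (k N) z) \<le> ?b N}"
  let ?P = "\<lambda>N. measure_pmf.prob (random_generators (G N) (k N))"
  have "(\<lambda>N. ?P N (- ?D N)) \<longlonglongrightarrow> 0"
    using diameter_upper_bound[OF GN n reg \<epsilon>] by (simp add: Collect_neg_eq)
  then have "(\<lambda>N. 1 - ?P N (- ?D N)) \<longlonglongrightarrow> 1 - 0"
    by (intro tendsto_intros)
  then show *: "(\<lambda>N. ?P N (?D N)) \<longlonglongrightarrow> 1"
    by (simp add: Compl_eq_Diff_UNIV measure_pmf.prob_compl[simplified])
  \<comment> \<open>Almost surely all generators lie in the group, where the two diameters are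
    comparable, so the undirected event contains the directed one up to a null set.\<close>
  have "?P N (?D N) \<le> ?P N (?U N)" for N
  proof (intro measure_pmf.finite_measure_mono_AE)
    show "AE z in measure_pmf (random_generators (G N) (k N)). z \<in> ?D N \<longrightarrow> z \<in> ?U N"
      using AE_random_generators[OF GN, where k = "k N"]
    proof eventually_elim
      case (elim z)
      then have "graph_diameter (cayley_graph (G N) (k N) z) \<le> graph_diameter (cayley_digraph (G N) (k N) z)"
        by (intro group.graph_diameter_cayley_graph_le GN) blast
      then show ?case
        by (blast intro: order_trans)
    qed
  qed auto
  then show "(\<lambda>N. ?P N (?U N)) \<longlonglongrightarrow> 1"
    by (intro tendsto_sandwich[OF _ _ * tendsto_const]) auto
next
  fix \<epsilon> :: real
  assume d: "filterlim d at_top sequentially"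
    and reg: "generator_regime l (\<lambda>N. 2 ^ d N)" and \<epsilon>: "\<epsilon> > 0"
  let ?R = "\<lambda>N. real (min_binomial (l N) (2 ^ d N))"
  let ?P = "\<lambda>N. measure_pmf.prob (random_generators (Z2_power (d N)) (l N))"
  let ?D = "\<lambda>N z. graph_diameter (cayley_digraph (Z2_power (d N)) (l N) z)"
  let ?U = "\<lambda>N z. graph_diameter (cayley_graph (Z2_power (d N)) (l N) z)"
  have n: "filterlim (\<lambda>N. 2 ^ d N :: nat) at_top sequentially"
    using d by (rule filterlim_at_top_mono) (simp add: less_imp_le)
  have reg': "generator_regime l (\<lambda>N. order (Z2_power (d N)))"
    and n': "filterlim (\<lambda>N. order (Z2_power (d N))) at_top sequentially"
    using reg n by (simp_all add: order_Z2_power)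
  have up: "(\<lambda>N. ?P N {z. \<not> ?D N z \<le> ereal ((1 + \<epsilon>) * ?R N)}) \<longlonglongrightarrow> 0"
    using diameter_upper_bound[OF group_Z2_power finite_Z2_power n' reg' \<epsilon>]
    by (simp add: order_Z2_power)
  have low: "\<forall>\<^sub>F N in sequentially. \<forall>z. (\<forall>i<l N. z i \<in> carrier (Z2_power (d N))) \<longrightarrow>
      ereal ((1 - \<epsilon>) * ?R N) < ?U N z"
    using diameter_lower_bound[OF comm_group_Z2_power finite_Z2_power Z2_power_square n' reg' \<epsilon>]
    by (simp add: order_Z2_power)
  have "filterlim ?R at_top sequentially"
    using generator_regime_bounds[OF reg n] by blast
  then have Rpos: "\<forall>\<^sub>F N in sequentially. 0 < ?R N"
    unfolding filterlim_at_top_dense by blast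
  \<comment> \<open>One argument serves both graphs: for any \<open>X\<close> between the two
    diameters a deviation can come, for large \<open>N\<close> and almost surely, only from too
    large a directed diameter.\<close>
  have conc: "(\<lambda>N. ?P N {z. \<bar>X N z / ereal (?R N) - 1\<bar> > ereal \<epsilon>}) \<longlonglongrightarrow> 0"
    if X: "\<And>N z. \<forall>i<l N. z i \<in> carrier (Z2_power (d N)) \<Longrightarrow> ?U N z \<le> X N z \<and> X N z \<le> ?D N z"
    for X :: "nat \<Rightarrow> (nat \<Rightarrow> nat \<Rightarrow> int) \<Rightarrow> ereal"
  proof (rule tendsto_sandwich[OF _ _ tendsto_const up])
    show "\<forall>\<^sub>F N in sequentially. ?P N {z. \<bar>X N z / ereal (?R N) - 1\<bar> > ereal \<epsilon>}
        \<le> ?P N {z. \<not> ?D N z \<le> ereal ((1 + \<epsilon>) * ?R N)}"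
      using low Rpos
    proof eventually_elim
      case (elim N)
      show ?case
      proof (rule measure_pmf.finite_measure_mono_AE)
        show "AE z in measure_pmf (random_generators (Z2_power (d N)) (l N)).
            z \<in> {z. \<bar>X N z / ereal (?R N) - 1\<bar> > ereal \<epsilon>} \<longrightarrow>
            z \<in> {z. \<not> ?D N z \<le> ereal ((1 + \<epsilon>) * ?R N)}"
          using AE_random_generators[OF group_Z2_power finite_Z2_power, where k = "l N"]
        proof eventually_elim
          case z: (elim z)
          have "ereal ((1 - \<epsilon>) * ?R N) < X N z"
            using elim(1) z X[OF z] by (blast intro: less_le_trans)
          moreover have "X N z \<le> ereal ((1 + \<epsilon>) * ?R N)" if "?D N z \<le> ereal ((1 + \<epsilon>) * ?R N)"
            using X[OF z] that by (blast intro: order_trans)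
          ultimately show ?case
            using elim(2) ereal_ratio_deviation[of "?R N" \<epsilon> "X N z"] by blast
        qed
      qed simp
    qed
  qed simp
  show "(\<lambda>N. ?P N {z. \<bar>?D N z / ereal (?R N) - 1\<bar> > ereal \<epsilon>}) \<longlonglongrightarrow> 0"
    by (intro conc conjI group.graph_diameter_cayley_graph_le[OF group_Z2_power]) auto
  show "(\<lambda>N. ?P N {z. \<bar>?U N z / ereal (?R N) - 1\<bar> > ereal \<epsilon>}) \<longlonglongrightarrow> 0"
    by (intro conc conjI group.graph_diameter_cayley_graph_le[OF group_Z2_power]) auto
qed

end
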